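(* Suppose that $k>1$. Let $\theta$ be any solution of $$(s^{\delta}(\theta')^k)'+s^{\delta}\big(bs\theta'+\kappa\theta+c_{n,k}^{-1}|\theta|^{q-1}\theta\big)=0\quad\text{in }(0,\infty)$$ such that $\lim_{s\to\infty}s^{\tilde\kappa}\theta(s)=0$, where $\tilde\kappa=\kappa/b$. Then $\theta$ has a compact support.
   Context: Here $n>2$ and $1\le k\le n$ are integers with $k$ odd, $q>k$ and $\kappa>0$ are real, $c_{n,k}=\frac1n\binom nk$, $b=\frac{2k}{k+1}$, $\delta=\frac{n(k+1)-2k}{2k}$. A solution of the equation is a function $\theta\in C^1((0,\infty))$ with $(\theta')^k\in C^1((0,\infty))$ satisfying the equation pointwise. "Compact support" means that $\theta$ vanishes identically for all sufficiently large $s$. *)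

theory Defs
  imports "HOL-Analysis.Analysis"
begin

definition c_coef :: "nat \<Rightarrow> nat \<Rightarrow> real" where
  "c_coef n k = (1 / real n) * real (n choose k)"

definition b_coef :: "nat \<Rightarrow> real" where
  "b_coef k = 2 * real k / (real k + 1)"

definition delta_exp :: "nat \<Rightarrow> nat \<Rightarrow> real" where
  "delta_exp n k = (real n * (real k + 1) - 2 * real k) / (2 * real k)"

(* The value of theta on (-oo, 0] is irrelevant: all conditions are pointwise in the open
   half-line.  Every derivative taken with deriv exists there by the two regularity
   conjuncts, the outer one since it is applied to a product of s powr delta with a C^1
   function. *)
definition is_solution :: "nat \<Rightarrow> nat \<Rightarrow> real \<Rightarrow> real \<Rightarrow> (real \<Rightarrow> real) \<Rightarrow> bool" where
  "is_solution n k q \<kappa> \<theta> \<longleftrightarrow>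
     \<theta> C1_differentiable_on {0<..} \<and>
     (\<lambda>s. (deriv \<theta> s) ^ k) C1_differentiable_on {0<..} \<and>
     (\<forall>s>0. deriv (\<lambda>t. t powr delta_exp n k * (deriv \<theta> t) ^ k) s
        + s powr delta_exp n k *
            (b_coef k * s * deriv \<theta> s + \<kappa> * \<theta> s
              + inverse (c_coef n k) * (\<bar>\<theta> s\<bar> powr (q - 1) * \<theta> s)) = 0)"

(* For functions on (0, oo): no condition is imposed near s = 0. *)
definition has_compact_support :: "(real \<Rightarrow> real) \<Rightarrow> bool" where
  "has_compact_support \<theta> \<longleftrightarrow> (\<exists>R>0. \<forall>s\<ge>R. \<theta> s = 0)"

end

theory Submission
  imports Defs
begin

text \<open>Put $a = \kappa/b$ and $w = (\theta')^k$, and let $M(s)$ be the supremum of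
  $t^a |\theta(t)|$ over $t \ge s$. The quantity $F = s^{a-1} w + b s^a \theta$ has derivative
  $(a-1-\delta) s^{a-2} w - c s^{a-1} |\theta|^{q-1} \theta$ and tends to $0$; integrating from
  $s$ to infinity gives $|F(s)| \le \varepsilon M(s)$ for large $s$. The $w$-term is controlled
  through the dissipation $b t (\theta')^2$ of the energy $(\theta')^{k+1}$. At an interior maximum
  of $t^a |\theta|$ one has $\theta' = -a \theta/t$, which is incompatible with $|F|$ being small
  because $k > 1$. Hence $t^a |\theta|$ eventually decreases, so $M(s) = s^a |\theta(s)|$ and
  $w$ is comparable to $-s \theta$; since $k > 1$, $\theta$ then vanishes in finite time.\<close>

section \<open>Calculus preliminaries\<close>

text \<open>Only \<open>v ^ k\<close> is assumed differentiable, not \<open>v\<close>. The product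
  is \<open>root k x * x\<close> evaluated at \<open>x = v t ^ k\<close>, and this function of
  \<open>x\<close> is differentiable everywhere, even at 0.\<close>

lemma has_real_derivative_mult_power_self:
  fixes v :: "real \<Rightarrow> real"
  assumes "odd k" and "((\<lambda>t. v t ^ k) has_real_derivative d) (at s)"
  shows "((\<lambda>t. v t * v t ^ k) has_real_derivative (1 + 1 / k) * v s * d) (at s)"
proof -
  have k: "k > 0" using assms(1) by (simp add: odd_pos)
  have root: "((\<lambda>x. root k x * x) has_real_derivative (1 + 1 / k) * root k x) (at x)" for x
  proof (cases "x = 0")
    case True
    \<comment> \<open>The root itself may fail to be differentiable at 0, but the difference
      quotient of \<open>root k h * h\<close> there is just \<open>root k h\<close>.\<close>
    have "(\<lambda>h. root k h) \<midarrow>0\<rightarrow> root k 0"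
      using isCont_real_root[of 0 k] by (simp add: isCont_def)
    then have "root k \<midarrow>0\<rightarrow> 0" by simp
    then have "(\<lambda>h. (root k h * h) / h) \<midarrow>0\<rightarrow> 0"
      by (rule Lim_transform_eventually) (auto simp: eventually_at_filter)
    then show ?thesis using True by (simp add: DERIV_def)
  next
    case False
    have "(root k has_real_derivative inverse (real k * root k x ^ (k - Suc 0))) (at x)"
      using DERIV_odd_real_root[OF assms(1) False] .
    then have "((\<lambda>x. root k x * x) has_real_derivative
        inverse (real k * root k x ^ (k - Suc 0)) * x + 1 * root k x) (at x)"
      by (rule DERIV_mult) (rule DERIV_ident)
    moreover have "x = root k x ^ (k - Suc 0) * root k x"
      using odd_real_root_pow[OF assms(1), of x] k power_minus_mult[of k "root k x"] by simp
    then have "inverse (real k * root k x ^ (k - Suc 0)) * x = root k x / k"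
      using False k by (simp add: field_simps)
    ultimately show ?thesis by (simp add: algebra_simps)
  qed
  have "root k (v t ^ k) = v t" for t
    using odd_real_root_power_cancel[OF assms(1)] .
  then show ?thesis
    using DERIV_chain2[OF root assms(2)] by simp
qed

text \<open>A nonincreasing function stays above its limit at infinity. Applied to a barrier plus or
  minus \<open>F\<close>, this replaces an integration up to infinity.\<close>

lemma nonneg_of_decreasing_to_0:
  fixes G g :: "real \<Rightarrow> real"
  assumes "\<And>t. t \<ge> s \<Longrightarrow> (G has_real_derivative g t) (at t)"
    and "\<And>t. t \<ge> s \<Longrightarrow> g t \<le> 0" and "(G \<longlongrightarrow> 0) at_top"
  shows "0 \<le> G s"
proof (rule tendsto_upperbound[OF assms(3)])
  have "G t \<le> G s" if "t \<ge> s" for t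
    using that assms(1,2) by (intro DERIV_nonpos_imp_nonincreasing[of s t G]) force+
  then show "\<forall>\<^sub>F t in at_top. G t \<le> G s"
    by (auto intro: eventually_at_top_linorderI)
qed simp

lemma odd_power_le_imp_le:
  fixes x y :: real
  assumes "odd k" and "x ^ k \<le> y ^ k"
  shows "x \<le> y"
  using assms(2) real_root_le_iff[of k "x ^ k" "y ^ k"] odd_real_root_power_cancel[OF assms(1)]
    odd_pos[OF assms(1)] by simp

section \<open>The profile equation and tail bounds\<close>

text \<open>Here \<open>v\<close> is the derivative of \<open>\<theta>\<close>, \<open>a\<close> is
  \<kappa>/b (so \<kappa> appears as \<open>a * b\<close>) and \<open>c\<close> is the inverse of
  \<open>c_coef n k\<close>. The equation is divided by s^\<delta> and solved for the derivative of
  \<open>v ^ k\<close>, since \<open>v\<close> may fail to be differentiable at its zeros.\<close>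

locale profile =
  fixes k :: nat and \<delta> b a c q :: real and \<theta> v :: "real \<Rightarrow> real"
  assumes odd_k: "odd k" and k_gt_1: "k > 1"
    and \<delta>_nonneg: "\<delta> \<ge> 0" and b_pos: "b > 0" and a_pos: "a > 0"
    and c_nonneg: "c \<ge> 0" and q_gt_1: "q > 1"
    and \<theta>_deriv: "s > 0 \<Longrightarrow> (\<theta> has_real_derivative v s) (at s)"
    and power_deriv: "s > 0 \<Longrightarrow> ((\<lambda>t. v t ^ k) has_real_derivative
      - (\<delta> / s) * v s ^ k - b * s * v s
        - (a * b * \<theta> s + c * (\<bar>\<theta> s\<bar> powr (q - 1) * \<theta> s))) (at s)"
    and decay: "((\<lambda>s. s powr a * \<theta> s) \<longlongrightarrow> 0) at_top"
begin

text \<open>Replaces the supremum M(s) by an arbitrary upper bound \<open>M\<close> of the weighted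
  tail. The caps \<open>1 \<le> s\<close> and \<open>M \<le> 1\<close> let powers be compared by
  their exponents alone.\<close>

definition dominated :: "real \<Rightarrow> real \<Rightarrow> bool" where
  "dominated s M \<longleftrightarrow> 1 \<le> s \<and> M \<le> 1 \<and> (\<forall>t\<ge>s. t powr a * \<bar>\<theta> t\<bar> \<le> M)"

definition source :: "real \<Rightarrow> real" where
  "source s = a * b * \<theta> s + c * (\<bar>\<theta> s\<bar> powr (q - 1) * \<theta> s)"

definition F :: "real \<Rightarrow> real" where
  "F s = s powr (a - 1) * v s ^ k + b * (s powr a * \<theta> s)"

lemma k_ge_3: "k \<ge> 3"
  using odd_k k_gt_1 by presburger

lemma dominated_nonneg: "dominated s M \<Longrightarrow> 0 \<le> M"
  unfolding dominated_def
  by (meson abs_ge_zero mult_nonneg_nonneg order_refl order_trans powr_ge_zero)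

lemma dominated_mono: "dominated s M \<Longrightarrow> s \<le> t \<Longrightarrow> dominated t M"
  unfolding dominated_def by auto

lemma dominated_bound:
  assumes "dominated s M" "s \<le> t"
  shows "\<bar>\<theta> t\<bar> \<le> M * t powr (- a)"
proof -
  have "t powr a * \<bar>\<theta> t\<bar> \<le> M" "t > 0" using assms unfolding dominated_def by auto
  then show ?thesis by (simp add: powr_minus field_simps)
qed

lemma dominated_le_1:
  assumes "dominated s M" "s \<le> t"
  shows "\<bar>\<theta> t\<bar> \<le> 1"
proof -
  have "t \<ge> 1" "M \<le> 1" using assms unfolding dominated_def by auto
  moreover have "t powr (- a) \<le> 1" using \<open>t \<ge> 1\<close> a_pos
    by (simp add: powr_minus inverse_le_1_iff ge_one_powr_ge_zero)
  ultimately have "M * t powr (- a) \<le> 1"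
    using dominated_nonneg[OF assms(1)] by (simp add: mult_le_one)
  then show ?thesis using dominated_bound[OF assms] by linarith
qed

lemma eventually_dominated:
  assumes "0 < M" "M \<le> 1"
  shows "\<exists>s. dominated s M"
proof -
  have "\<forall>\<^sub>F s in at_top. dist (s powr a * \<theta> s) 0 < M"
    using decay assms(1) by (rule tendstoD)
  then obtain S where "\<And>s. s \<ge> S \<Longrightarrow> \<bar>s powr a * \<theta> s\<bar> < M"
    by (auto simp: eventually_at_top_linorder)
  then have "dominated (max 1 S) M" using assms
    by (auto simp: dominated_def abs_mult less_imp_le)
  then show ?thesis by blast
qed

lemma source_bound:
  assumes "\<bar>\<theta> s\<bar> \<le> 1"
  shows "\<bar>source s\<bar> \<le> (a * b + c) * \<bar>\<theta> s\<bar>"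
proof -
  have "\<bar>\<theta> s\<bar> powr (q - 1) \<le> 1" using assms q_gt_1 by (simp add: powr_le1)
  then have "c * (\<bar>\<theta> s\<bar> powr (q - 1) * \<bar>\<theta> s\<bar>) \<le> c * (1 * \<bar>\<theta> s\<bar>)"
    using c_nonneg by (intro mult_left_mono mult_right_mono) auto
  moreover have "\<bar>source s\<bar> \<le> a * b * \<bar>\<theta> s\<bar> + c * (\<bar>\<theta> s\<bar> powr (q - 1) * \<bar>\<theta> s\<bar>)"
    unfolding source_def using a_pos b_pos c_nonneg
    by (intro order_trans[OF abs_triangle_ineq]) (simp add: abs_mult)
  ultimately show ?thesis by (simp add: algebra_simps)
qed

section \<open>Flux identities and a first bound on \<open>v ^ k\<close>\<close>

text \<open>s^\<delta> is the integrating factor for the term (\<delta>/s) v^k, and the second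
  summand absorbs b s v. Only \<theta> remains on the right, so increments of the flux are
  controlled without knowing \<open>v\<close>.\<close>

lemma flux_deriv:
  assumes "s > 0"
  shows "((\<lambda>t. t powr \<delta> * v t ^ k + b * (t powr (\<delta> + 1) * \<theta> t)) has_real_derivative
    s powr \<delta> * (b * (\<delta> + 1) * \<theta> s - source s)) (at s)"
proof -
  have p: "s powr \<delta> = s * s powr (\<delta> - 1)" "s powr (\<delta> + 1) = s * (s * s powr (\<delta> - 1))"
    using assms powr_mult_base[of s "\<delta> - 1"] powr_mult_base[of s "\<delta>"]
    by (simp_all add: add.commute)
  have e: "\<delta> + 1 - 1 = \<delta>" by simp
  show ?thesis
    by (rule derivative_eq_intros power_deriv \<theta>_deriv has_real_derivative_powr assms refl)+
      (use assms in \<open>simp only: e p source_def, simp add: field_simps\<close>)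
qed

text \<open>The weight s^(a-1) is the one for which both b s v and a b \<theta> cancel against the
  derivative of b s^a \<theta>.\<close>

lemma F_deriv:
  assumes "s > 0"
  shows "(F has_real_derivative (a - 1 - \<delta>) * (s powr (a - 2) * v s ^ k)
    - c * (s powr (a - 1) * (\<bar>\<theta> s\<bar> powr (q - 1) * \<theta> s))) (at s)"
proof -
  have p: "s powr (a - 1) = s * s powr (a - 2)" "s powr a = s * (s * s powr (a - 2))"
    using assms powr_mult_base[of s "a - 2"] powr_mult_base[of s "a - 1"]
    by (simp_all add: add.commute)
  have e: "a - 1 - 1 = a - 2" by simp
  show ?thesis unfolding F_def
    by (rule derivative_eq_intros power_deriv \<theta>_deriv has_real_derivative_powr assms refl)+
      (use assms in \<open>simp add: e p field_simps\<close>)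
qed

lemma power_le_self: "0 \<le> x \<Longrightarrow> x \<le> 1 \<Longrightarrow> x ^ k \<le> (x::real)"
  using power_decreasing[of 1 k x] k_gt_1 by simp

text \<open>The mean value theorem on $[s, 2s]$ yields a point where \<^term>\<open>v\<close> is tiny; the flux
  identity carries the bound from there back to \<^term>\<open>s\<close>.\<close>

lemma flux_bound:
  obtains C where "C \<ge> 1"
    "\<And>s M. dominated s M \<Longrightarrow> \<bar>v s ^ k\<bar> \<le> C * (s powr (1 - a) * M)"
proof
  define K where "K = b * (\<delta> + 1) + a * b + c"
  \<comment> \<open>Besides 1, the summands bound in turn \<theta> at \<open>s\<close>, the flux
    increment on [s, x], and the \<open>v\<close> and \<theta> terms of the flux at
    \<open>x\<close>.\<close>
  define C where "C = 1 + b + K * 2 powr \<delta> + 2 powr \<delta> * 2 ^ k + b * 2 powr (\<delta> + 1)"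
  have K: "K \<ge> 0" unfolding K_def using \<delta>_nonneg a_pos b_pos c_nonneg by simp
  show "C \<ge> 1" unfolding C_def using K b_pos by simp
  fix s M assume dom: "dominated s M"
  have s: "s \<ge> 1" and M: "0 \<le> M" "M \<le> 1" using dom dominated_nonneg by (auto simp: dominated_def)
  \<comment> \<open>Since t^(-a) decreases, \<open>y\<close> bounds |\<theta>| on all of [s,
    \<infinity>).\<close>
  define y where "y = M * s powr (- a)"
  have y: "0 \<le> y" "y \<le> 1"
    using M s a_pos unfolding y_def
    by (auto simp: powr_minus inverse_le_1_iff ge_one_powr_ge_zero intro!: mult_le_one)
  have th: "\<bar>\<theta> t\<bar> \<le> y" if "t \<ge> s" for t
  proof -
    have "t powr (- a) \<le> s powr (- a)" using that s a_pos by (intro powr_mono2') auto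
    then show ?thesis
      using dominated_bound[OF dom that] M unfolding y_def by (meson mult_left_mono order_trans)
  qed
  obtain x where x: "s < x" "x < 2 * s" "\<theta> (2 * s) - \<theta> s = (2 * s - s) * v x"
    using MVT2[of s "2 * s" \<theta> v] \<theta>_deriv s by force
  have "s * \<bar>v x\<bar> \<le> 2 * y"
  proof -
    have "s * v x = \<theta> (2 * s) - \<theta> s" using x(3) by simp
    then have "\<bar>s * v x\<bar> \<le> 2 * y" using th[of s] th[of "2 * s"] s by linarith
    then show ?thesis using s by (simp add: abs_mult)
  qed
  moreover have "1 * \<bar>v x\<bar> \<le> s * \<bar>v x\<bar>" using s by (intro mult_right_mono) auto
  ultimately have "\<bar>v x\<bar> ^ k \<le> (2 * y) ^ k" by (intro power_mono) auto
  \<comment> \<open>As \<open>y \<le> 1\<close>, the power \<open>y ^ k\<close> is at most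
    \<open>y\<close>, which keeps the bound linear in \<open>M\<close>.\<close>
  then have vx: "\<bar>v x ^ k\<bar> \<le> 2 ^ k * y"
    using order_trans[OF _ mult_left_mono[OF power_le_self[OF y], of "2 ^ k"]]
    by (simp only: power_abs power_mult_distrib) simp
  let ?G = "\<lambda>t. t powr \<delta> * v t ^ k + b * (t powr (\<delta> + 1) * \<theta> t)"
  obtain z where z: "s < z" "z < x"
      "?G x - ?G s = (x - s) * (z powr \<delta> * (b * (\<delta> + 1) * \<theta> z - source z))"
    using MVT2[of s x ?G "\<lambda>z. z powr \<delta> * (b * (\<delta> + 1) * \<theta> z - source z)"] flux_deriv s x by force
  define p where "p = s powr \<delta>"
  have p: "p > 0" unfolding p_def using s by simp
  have ps: "s powr (\<delta> + 1) = s * p" "(2 * s) powr \<delta> = 2 powr \<delta> * p"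
    "(2 * s) powr (\<delta> + 1) = 2 powr (\<delta> + 1) * (s * p)"
    unfolding p_def using s by (simp_all add: powr_mult powr_add)
  have "\<bar>b * (\<delta> + 1) * \<theta> z - source z\<bar> \<le> b * (\<delta> + 1) * \<bar>\<theta> z\<bar> + (a * b + c) * \<bar>\<theta> z\<bar>"
    using source_bound[of z] dominated_le_1[OF dom, of z] z \<delta>_nonneg b_pos
      abs_triangle_ineq4[of "b * (\<delta> + 1) * \<theta> z" "source z"] by (simp add: abs_mult)
  also have "\<dots> = K * \<bar>\<theta> z\<bar>" unfolding K_def by (simp add: algebra_simps)
  also have "\<dots> \<le> K * y" using K th[of z] z by (intro mult_left_mono) auto
  finally have d: "\<bar>b * (\<delta> + 1) * \<theta> z - source z\<bar> \<le> K * y" .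
  have "z powr \<delta> \<le> 2 powr \<delta> * p"
    unfolding ps(2)[symmetric] using z x s \<delta>_nonneg by (intro powr_mono2) auto
  then have "\<bar>?G x - ?G s\<bar> \<le> s * ((2 powr \<delta> * p) * (K * y))"
    unfolding z(3) abs_mult using d x z s p by (intro mult_mono) auto
  moreover have "\<bar>x powr \<delta> * v x ^ k\<bar> \<le> (2 powr \<delta> * p) * (2 ^ k * y)"
    unfolding abs_mult ps(2)[symmetric] using vx x s \<delta>_nonneg
    by (intro mult_mono) (auto intro!: powr_mono2)
  moreover have "\<bar>b * (x powr (\<delta> + 1) * \<theta> x)\<bar> \<le> b * ((2 powr (\<delta> + 1) * (s * p)) * y)"
    unfolding abs_mult ps(3)[symmetric] using x s \<delta>_nonneg b_pos th[of x]
    by (intro mult_mono) (auto intro!: powr_mono2)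
  moreover have "\<bar>b * (s powr (\<delta> + 1) * \<theta> s)\<bar> \<le> b * ((s * p) * y)"
    unfolding abs_mult ps(1) using s p b_pos th[of s] by (intro mult_mono) auto
  ultimately have "\<bar>s powr \<delta> * v s ^ k\<bar> \<le> s * ((2 powr \<delta> * p) * (K * y))
      + (2 powr \<delta> * p) * (2 ^ k * y) + b * ((2 powr (\<delta> + 1) * (s * p)) * y) + b * ((s * p) * y)"
    by linarith
  \<comment> \<open>A spare factor \<open>s \<ge> 1\<close> brings this term to the order of the
    others.\<close>
  also have "(2 powr \<delta> * p) * (2 ^ k * y) \<le> s * ((2 powr \<delta> * p) * (2 ^ k * y))"
    using s p y mult_right_mono[of 1 s "(2 powr \<delta> * p) * (2 ^ k * y)"] by simp
  finally have "\<bar>s powr \<delta> * v s ^ k\<bar> \<le> p * ((C - 1) * (s * y))"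
    unfolding C_def by (simp add: algebra_simps)
  then have "\<bar>v s ^ k\<bar> \<le> (C - 1) * (s * y)"
    using p unfolding abs_mult p_def[symmetric] by simp
  also have "\<dots> \<le> C * (s * y)" using s y by (intro mult_right_mono) auto
  also have "s * y = s powr (1 - a) * M"
    unfolding y_def using s by (simp add: powr_mult_base[symmetric] powr_diff powr_minus field_simps)
  finally show "\<bar>v s ^ k\<bar> \<le> C * (s powr (1 - a) * M)" .
qed

text \<open>The weight in \<open>F\<close> matches the order s^(1-a) of \<open>flux_bound\<close>,
  so |F| is at most (C + b) M, and the decay hypothesis makes \<open>M\<close> as small as
  desired.\<close>

lemma F_tendsto: "(F \<longlongrightarrow> 0) at_top"
proof (rule tendstoI)
  fix e :: real assume e: "e > 0"
  obtain C where C: "C \<ge> 1"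
    "\<And>s M. dominated s M \<Longrightarrow> \<bar>v s ^ k\<bar> \<le> C * (s powr (1 - a) * M)"
    using flux_bound by blast
  define M where "M = min 1 (e / (2 * (C + b)))"
  have M: "0 < M" "M \<le> 1" "M \<le> e / (2 * (C + b))" unfolding M_def using e C b_pos by auto
  have CM: "(C + b) * M < e"
    using M(3) C b_pos e by (simp add: field_simps)
  obtain s where s: "dominated s M" using eventually_dominated[OF M(1,2)] by blast
  have "\<bar>F t\<bar> < e" if "t \<ge> s" for t
  proof -
    have dom: "dominated t M" using dominated_mono[OF s that] .
    then have t: "t \<ge> 1" and g: "t powr a * \<bar>\<theta> t\<bar> \<le> M" by (auto simp: dominated_def)
    have "t powr (a - 1) * \<bar>v t ^ k\<bar> \<le> t powr (a - 1) * (C * (t powr (1 - a) * M))"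
      using C(2)[OF dom] by (intro mult_left_mono) auto
    also have "\<dots> = C * M" using t by (simp add: powr_diff)
    finally have "t powr (a - 1) * \<bar>v t ^ k\<bar> \<le> C * M" .
    moreover have "b * (t powr a * \<bar>\<theta> t\<bar>) \<le> b * M" using g b_pos by simp
    moreover have "\<bar>F t\<bar> \<le> t powr (a - 1) * \<bar>v t ^ k\<bar> + b * (t powr a * \<bar>\<theta> t\<bar>)"
      unfolding F_def using b_pos
      by (intro order_trans[OF abs_triangle_ineq]) (simp add: abs_mult)
    ultimately show ?thesis using CM by (simp add: algebra_simps)
  qed
  then show "\<forall>\<^sub>F s in at_top. dist (F s) 0 < e"
    by (auto simp: eventually_at_top_linorder)
qed

section \<open>Energy dissipation\<close>

definition energy_slope :: "real \<Rightarrow> real" where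
  "energy_slope t = (1 + 1 / k) * v t * (- (\<delta> / t) * v t ^ k - b * t * v t - source t)"

lemma energy_deriv:
  "t > 0 \<Longrightarrow> ((\<lambda>t. v t * v t ^ k) has_real_derivative energy_slope t) (at t)"
  using has_real_derivative_mult_power_self[OF odd_k power_deriv]
  by (simp add: energy_slope_def source_def)

lemma energy_nonneg: "0 \<le> v t * v t ^ k"
  using odd_k zero_le_even_power[of "Suc k" "v t"] by simp

text \<open>The damping term has a favourable sign, and half of the dissipation b t v^2 absorbs the
  cross term \<open>v t * source t\<close> by Young's inequality.\<close>

lemma energy_slope_le:
  assumes dom: "dominated s M" and t: "s \<le> t"
  shows "energy_slope t
    \<le> - (b / 2) * (t * (v t)\<^sup>2) + (a * b + c)\<^sup>2 / b * (M * t powr (- a - 1))"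
proof -
  define L where "L = a * b + c"
  define y where "y = M * t powr (- a)"
  have t1: "t \<ge> 1" using dom t by (auto simp: dominated_def)
  have th: "\<bar>\<theta> t\<bar> \<le> y" "\<bar>\<theta> t\<bar> \<le> 1"
    unfolding y_def using dominated_bound[OF dom t] dominated_le_1[OF dom t] by auto
  have "(source t)\<^sup>2 \<le> (L * \<bar>\<theta> t\<bar>)\<^sup>2"
    using source_bound[OF th(2)] unfolding L_def by (simp add: abs_le_square_iff[symmetric])
  \<comment> \<open>One factor |\<theta>| \<le> 1 is given up so that the remainder is linear in
    \<open>M\<close>.\<close>
  also have "\<dots> \<le> L\<^sup>2 * \<bar>\<theta> t\<bar>"
    unfolding power_mult_distrib using th(2) power_decreasing[of 1 2 "\<bar>\<theta> t\<bar>"]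
    by (intro mult_left_mono) auto
  also have "\<dots> \<le> L\<^sup>2 * y" using th(1) by (intro mult_left_mono) auto
  finally have f2: "(source t)\<^sup>2 \<le> L\<^sup>2 * y" .
  define U where "U = (b / 2) * (t * (v t)\<^sup>2)"
  define V where "V = L\<^sup>2 * y / (2 * b * t)"
  define Z where "Z = - (\<delta> / t) * (v t * v t ^ k) - b * t * (v t)\<^sup>2 - v t * source t"
  \<comment> \<open>Completing the square: this is Young's inequality with weights that cost exactly
    one \<open>U\<close>.\<close>
  have "0 \<le> (b * t * v t + source t)\<^sup>2 / (2 * b * t)"
    using b_pos t1 by simp
  also have "\<dots> = U + v t * source t + (source t)\<^sup>2 / (2 * b * t)"
    using b_pos t1 unfolding U_def by (simp add: field_simps power2_eq_square)
  also have "(source t)\<^sup>2 / (2 * b * t) \<le> V"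
    unfolding V_def using f2 b_pos t1 by (intro divide_right_mono) auto
  finally have "- (v t * source t) \<le> U + V" by linarith
  moreover have "0 \<le> \<delta> / t * (v t * v t ^ k)"
    using \<delta>_nonneg t1 by (intro mult_nonneg_nonneg[OF _ energy_nonneg]) auto
  moreover have "b * t * (v t)\<^sup>2 = 2 * U" unfolding U_def by simp
  ultimately have Z: "Z \<le> - U + V" unfolding Z_def by linarith
  have nn: "0 \<le> U" "0 \<le> V"
    unfolding U_def V_def y_def using b_pos t1 dominated_nonneg[OF dom] by simp_all
  have k1: "0 \<le> 1 / real k" "1 / real k \<le> 1" using k_gt_1 by auto
  have "energy_slope t = (1 + 1 / k) * Z"
    unfolding energy_slope_def Z_def by (simp add: algebra_simps power2_eq_square)
  also have "\<dots> \<le> (1 + 1 / k) * (- U + V)" using Z k1 by (intro mult_left_mono) auto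
  \<comment> \<open>The factor \<open>1 + 1 / k\<close> lies between 1 and 2: at least one
    \<open>U\<close> is kept, at most two \<open>V\<close> are paid.\<close>
  also have "\<dots> \<le> - U + 2 * V"
    using mult_right_mono[OF k1(2) nn(2)] mult_nonneg_nonneg[OF k1(1) nn(1)]
    by (simp add: algebra_simps diff_divide_distrib)
  also have "2 * V = L\<^sup>2 / b * (M * t powr (- a - 1))"
    unfolding V_def y_def using t1 b_pos by (simp add: powr_diff field_simps)
  finally show ?thesis unfolding U_def L_def by simp
qed

section \<open>Smallness of \<open>F\<close> relative to the tail bound\<close>

text \<open>\<open>flux_bound\<close> gives only a constant times \<open>M\<close>. The small factor
  comes from a barrier \<open>H\<close> that tends to 0, decreases at least as fast as |F| can
  change, and is \<open>M\<close> times a quantity vanishing at infinity.\<close>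

lemma F_bound:
  assumes "e > 0"
  obtains S where "\<And>s M. dominated s M \<Longrightarrow> S \<le> s \<Longrightarrow> \<bar>F s\<bar> \<le> e * M"
proof -
  obtain C where C: "C \<ge> 1"
    "\<And>s M. dominated s M \<Longrightarrow> \<bar>v s ^ k\<bar> \<le> C * (s powr (1 - a) * M)"
    using flux_bound by blast
  \<comment> \<open>The extra decay supplied by |\<theta>|^(q-1).\<close>
  define \<eta> where "\<eta> = a * (q - 1)"
  define N where "N = \<bar>a - 1 - \<delta>\<bar>"
  \<comment> \<open>\<open>A * b / 2 = N * C\<close> makes the dissipation pay for the v^k term of
    F'. \<open>D\<close> is chosen so that -2/3 D M t^(-5/3) cancels the remaining energy terms,
    \<open>D'\<close> so that D' M t^(-\<eta>) has derivative -c M t^(-\<eta>-1).\<close>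
  define A where "A = 2 * N * C / b"
  define B where "B = (a * b + c)\<^sup>2 / b"
  define D where "D = 3 / 2 * A * (\<bar>a - 2\<bar> * C\<^sup>2 + B)"
  define D' where "D' = c / \<eta>"
  have \<eta>: "\<eta> > 0" unfolding \<eta>_def using a_pos q_gt_1 by simp
  have pos: "N \<ge> 0" "A \<ge> 0" "B \<ge> 0" "D \<ge> 0" "D' \<ge> 0"
    unfolding N_def A_def B_def D_def D'_def using C(1) b_pos c_nonneg \<eta> by simp_all
  have "((\<lambda>s::real. s powr (- 2 / 3)) \<longlongrightarrow> 0) at_top" "((\<lambda>s. s powr (- \<eta>)) \<longlongrightarrow> 0) at_top"
    using \<eta> by (simp_all add: tendsto_neg_powr filterlim_ident)
  then have rate: "((\<lambda>s. (A * C\<^sup>2 + D) * s powr (- 2 / 3) + D' * s powr (- \<eta>)) \<longlongrightarrow> 0) at_top"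
    by (intro tendsto_add_zero tendsto_mult_right_zero)
  have main: "\<bar>F s\<bar> \<le> M * ((A * C\<^sup>2 + D) * s powr (- 2 / 3) + D' * s powr (- \<eta>))"
    if dom: "dominated s M" for s M
  proof -
    have s: "s \<ge> 1" and M: "0 \<le> M" "M \<le> 1" using dom dominated_nonneg by (auto simp: dominated_def)
    define E where "E t = v t * v t ^ k" for t
    define H where
      "H t = A * (t powr (a - 2) * E t) + D * M * t powr (- 2 / 3) + D' * M * t powr (- \<eta>)" for t
    define h where "h t = A * ((a - 2) * t powr (a - 3) * E t + t powr (a - 2) * energy_slope t)
      - 2 / 3 * D * M * t powr (- 5 / 3) - c * M * t powr (- \<eta> - 1)" for t
    define f where "f t = (a - 1 - \<delta>) * (t powr (a - 2) * v t ^ k)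
      - c * (t powr (a - 1) * (\<bar>\<theta> t\<bar> powr (q - 1) * \<theta> t))" for t
    have w: "\<bar>v t ^ k\<bar> \<le> C * (t powr (1 - a) * M)" if "t \<ge> s" for t
      using C(2) dominated_mono[OF dom that] .
    \<comment> \<open>From |v|^k \<le> C t: since k \<ge> 3, the number C t^(1/3) \<ge> 1 has a k-th
      power at least C t. For the second bound, split |v|^k as |v|^(k-2) v^2, which turns it into a
      multiple of the dissipation.\<close>
    have v: "\<bar>v t\<bar> \<le> C * t powr (1 / 3)" and vk: "\<bar>v t ^ k\<bar> \<le> C * t * (v t)\<^sup>2"
      if ts: "t \<ge> s" for t
    proof -
      have t: "t \<ge> 1" using s ts by simp
      have "t powr (1 - a) * M \<le> t powr 1 * 1"
        using t a_pos M by (intro mult_mono powr_mono) auto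
      then have "C * (t powr (1 - a) * M) \<le> C * t" using C(1) t by (intro mult_left_mono) auto
      then have wt: "\<bar>v t ^ k\<bar> \<le> C * t" using w[OF ts] by linarith
      define y where "y = C * t powr (1 / 3)"
      have y: "y \<ge> 1" unfolding y_def
        using C(1) t mult_mono[of 1 C 1 "t powr (1 / 3)"] by (simp add: ge_one_powr_ge_zero)
      have "C * t \<le> C ^ 3 * t" using C(1) t power_increasing[of 1 3 C] by (intro mult_right_mono) auto
      also have "\<dots> = y ^ 3"
        unfolding y_def power_mult_distrib using t by (simp add: powr_power)
      also have "\<dots> \<le> y ^ k" using y k_ge_3 by (intro power_increasing) auto
      finally have "\<bar>v t\<bar> ^ k \<le> y ^ k" using wt by (simp add: power_abs)
      then show "\<bar>v t\<bar> \<le> C * t powr (1 / 3)"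
        unfolding y_def[symmetric] using y k_gt_1 by (simp add: power_mono_iff)
      have Ct: "1 \<le> C * t" using C(1) t mult_mono[of 1 C 1 t] by simp
      have "\<bar>v t\<bar> ^ (k - 2) \<le> C * t"
      proof (cases "\<bar>v t\<bar> \<le> 1")
        case True
        then show ?thesis using Ct power_le_one[of "\<bar>v t\<bar>" "k - 2"] by linarith
      next
        case False
        then have "\<bar>v t\<bar> ^ (k - 2) \<le> \<bar>v t\<bar> ^ k" by (intro power_increasing) auto
        then show ?thesis using wt by (simp add: power_abs)
      qed
      then have "\<bar>v t\<bar> ^ (k - 2) * (v t)\<^sup>2 \<le> C * t * (v t)\<^sup>2" by (intro mult_right_mono) auto
      also have "\<bar>v t\<bar> ^ (k - 2) * (v t)\<^sup>2 = \<bar>v t\<bar> ^ (k - 2 + 2)"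
        by (simp only: power_add power2_abs)
      also have "\<dots> = \<bar>v t ^ k\<bar>" using k_gt_1 by (simp add: power_abs del: power_Suc add_2_eq_Suc')
      finally show "\<bar>v t ^ k\<bar> \<le> C * t * (v t)\<^sup>2" .
    qed
    \<comment> \<open>Times t^(a-2) this is of order t^(-2/3), which decays whatever
      \<open>a\<close> is; the exponent 1/3 from k \<ge> 3 makes this possible.\<close>
    have E: "E t \<le> C\<^sup>2 * (M * t powr (4 / 3 - a))" if ts: "t \<ge> s" for t
    proof -
      have "E t \<le> \<bar>v t\<bar> * \<bar>v t ^ k\<bar>" unfolding E_def abs_mult[symmetric] by simp
      also have "\<dots> \<le> (C * t powr (1 / 3)) * (C * (t powr (1 - a) * M))"
        using v[OF ts] w[OF ts] C(1) by (intro mult_mono) auto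
      also have "\<dots> = C\<^sup>2 * (M * (t powr (1 / 3) * t powr (1 - a)))"
        by (simp add: power2_eq_square)
      also have "t powr (1 / 3) * t powr (1 - a) = t powr (4 / 3 - a)"
        by (simp add: powr_add[symmetric])
      finally show ?thesis .
    qed
    have Hd: "(H has_real_derivative h t) (at t)" if "t \<ge> s" for t
    proof -
      have t: "t > 0" using s that by simp
      have e: "a - 2 - 1 = a - 3" "- 2 / 3 - 1 = - 5 / (3 :: real)" by simp_all
      have "(H has_real_derivative
          A * ((a - 2) * t powr (a - 2 - 1) * E t + energy_slope t * t powr (a - 2))
          + D * M * (- 2 / 3 * t powr (- 2 / 3 - 1)) + D' * M * (- \<eta> * t powr (- \<eta> - 1))) (at t)"
        unfolding H_def E_def
        by (intro DERIV_add DERIV_cmult DERIV_mult has_real_derivative_powr t energy_deriv)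
      moreover have "D' * M * (- \<eta> * t powr (- \<eta> - 1)) = - (c * M * t powr (- \<eta> - 1))"
        unfolding D'_def using \<eta> by simp
      moreover have "A * ((a - 2) * t powr (a - 3) * E t + energy_slope t * t powr (a - 2))
          + D * M * (- 2 / 3 * t powr (- 5 / 3)) + - (c * M * t powr (- \<eta> - 1)) = h t"
        unfolding h_def by (simp add: algebra_simps)
      ultimately show ?thesis unfolding e by metis
    qed
    have Fd: "(F has_real_derivative f t) (at t)" if "t \<ge> s" for t
      unfolding f_def using F_deriv that s by simp
    \<comment> \<open>The barrier inequality: \<open>X\<close> is the weighted dissipation, and
      \<open>Y\<close> collects the error terms of the energy.\<close>
    have fh: "\<bar>f t\<bar> \<le> - h t" if ts: "t \<ge> s" for t
    proof -
      have t: "t \<ge> 1" using s ts by simp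
      define X where "X = t powr (a - 1) * (v t)\<^sup>2"
      define Y where "Y = M * t powr (- 5 / 3)"
      have "t powr (a - 3) * E t \<le> t powr (a - 3) * (C\<^sup>2 * (M * t powr (4 / 3 - a)))"
        using E[OF ts] by (intro mult_left_mono) auto
      also have "\<dots> = C\<^sup>2 * (M * (t powr (a - 3) * t powr (4 / 3 - a)))" by simp
      also have "t powr (a - 3) * t powr (4 / 3 - a) = t powr (- 5 / 3)"
        by (simp add: powr_add[symmetric])
      finally have "\<bar>a - 2\<bar> * (t powr (a - 3) * E t) \<le> \<bar>a - 2\<bar> * (C\<^sup>2 * Y)"
        unfolding Y_def by (intro mult_left_mono) auto
      moreover have "(a - 2) * (t powr (a - 3) * E t) \<le> \<bar>a - 2\<bar> * (t powr (a - 3) * E t)"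
        unfolding E_def using energy_nonneg[of t] by (intro mult_right_mono mult_nonneg_nonneg[of "_ powr _"]) auto
      ultimately have h1: "(a - 2) * t powr (a - 3) * E t \<le> \<bar>a - 2\<bar> * C\<^sup>2 * Y" by simp
      have "t powr (a - 2) * energy_slope t \<le> t powr (a - 2) *
          (- (b / 2) * (t * (v t)\<^sup>2) + B * (M * t powr (- a - 1)))"
        using energy_slope_le[OF dom ts] unfolding B_def by (intro mult_left_mono) auto
      also have "\<dots> = - (b / 2) * ((t * t powr (a - 2)) * (v t)\<^sup>2)
          + B * (M * (t powr (a - 2) * t powr (- a - 1)))" by (simp add: algebra_simps)
      also have "t * t powr (a - 2) = t powr (a - 1)" using t powr_mult_base[of t "a - 2"] by simp
      also have "t powr (a - 2) * t powr (- a - 1) = t powr (- 3)"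
        by (simp add: powr_add[symmetric])
      also have "B * (M * t powr (- 3)) \<le> B * Y"
        unfolding Y_def using pos M t by (intro mult_left_mono powr_mono) auto
      finally have h2: "t powr (a - 2) * energy_slope t \<le> - (b / 2) * X + B * Y"
        unfolding X_def by simp
      have "h t \<le> A * (\<bar>a - 2\<bar> * C\<^sup>2 * Y + (- (b / 2) * X + B * Y))
          - 2 / 3 * D * Y - c * M * t powr (- \<eta> - 1)"
        unfolding h_def using mult_left_mono[OF add_mono[OF h1 h2] pos(2)]
        by (simp add: Y_def)
      also have "\<dots> = - (A * b / 2 * X) - c * M * t powr (- \<eta> - 1)"
        unfolding D_def by (simp add: algebra_simps)
      also have "A * b / 2 = N * C" unfolding A_def using b_pos by simp
      finally have h: "h t \<le> - (N * C * X) - c * M * t powr (- \<eta> - 1)" .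
      have "t powr (a - 2) * \<bar>v t ^ k\<bar> \<le> t powr (a - 2) * (C * t * (v t)\<^sup>2)"
        using vk[OF ts] by (intro mult_left_mono) auto
      also have "\<dots> = C * ((t * t powr (a - 2)) * (v t)\<^sup>2)" by simp
      also have "t * t powr (a - 2) = t powr (a - 1)" using t powr_mult_base[of t "a - 2"] by simp
      finally have f1: "N * (t powr (a - 2) * \<bar>v t ^ k\<bar>) \<le> N * (C * X)"
        unfolding X_def using pos by (intro mult_left_mono) auto
      \<comment> \<open>\<open>M \<le> 1\<close> is used only inside the factor |\<theta>|^(q-1);
        the other factor |\<theta>| retains \<open>M\<close>.\<close>
      have "\<bar>\<theta> t\<bar> \<le> t powr (- a)"
        using dominated_bound[OF dom ts] M mult_right_mono[of M 1 "t powr (- a)"] by simp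
      then have "\<bar>\<theta> t\<bar> powr (q - 1) \<le> (t powr (- a)) powr (q - 1)"
        using q_gt_1 by (intro powr_mono2) auto
      also have "\<dots> = t powr (- \<eta>)" unfolding \<eta>_def by (simp add: powr_powr)
      finally have "t powr (a - 1) * (\<bar>\<theta> t\<bar> powr (q - 1) * \<bar>\<theta> t\<bar>)
          \<le> t powr (a - 1) * (t powr (- \<eta>) * (M * t powr (- a)))"
        using dominated_bound[OF dom ts] by (intro mult_left_mono mult_mono) auto
      also have "\<dots> = M * t powr (- \<eta> - 1)"
      proof -
        have "(a - 1) + (- \<eta> + - a) = - \<eta> - 1" by simp
        then have "t powr (a - 1) * (t powr (- \<eta>) * t powr (- a)) = t powr (- \<eta> - 1)"
          unfolding powr_add[symmetric] by (rule arg_cong)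
        then show ?thesis by (simp only: mult.left_commute[of _ M])
      qed
      finally have f2: "c * (t powr (a - 1) * (\<bar>\<theta> t\<bar> powr (q - 1) * \<bar>\<theta> t\<bar>))
          \<le> c * (M * t powr (- \<eta> - 1))" using c_nonneg by (intro mult_left_mono) auto
      have "\<bar>f t\<bar> \<le> N * (t powr (a - 2) * \<bar>v t ^ k\<bar>)
          + c * (t powr (a - 1) * (\<bar>\<theta> t\<bar> powr (q - 1) * \<bar>\<theta> t\<bar>))"
        unfolding f_def N_def using c_nonneg
        by (intro order_trans[OF abs_triangle_ineq4]) (simp add: abs_mult)
      then show ?thesis using f1 f2 h by simp
    qed
    have H_le: "H t \<le> M * ((A * C\<^sup>2 + D) * t powr (- 2 / 3) + D' * t powr (- \<eta>))"
      if ts: "t \<ge> s" for t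
    proof -
      have "t powr (a - 2) * E t \<le> t powr (a - 2) * (C\<^sup>2 * (M * t powr (4 / 3 - a)))"
        using E[OF ts] by (intro mult_left_mono) auto
      also have "\<dots> = C\<^sup>2 * (M * (t powr (a - 2) * t powr (4 / 3 - a)))" by simp
      also have "t powr (a - 2) * t powr (4 / 3 - a) = t powr (- 2 / 3)"
        by (simp add: powr_add[symmetric])
      finally have "A * (t powr (a - 2) * E t) \<le> A * (C\<^sup>2 * (M * t powr (- 2 / 3)))"
        using pos by (intro mult_left_mono) auto
      then show ?thesis unfolding H_def by (simp add: algebra_simps)
    qed
    have H0: "H t \<ge> 0" for t
      unfolding H_def E_def using pos M energy_nonneg[of t] by simp
    have "\<forall>\<^sub>F t in at_top. 0 \<le> H t"
      "\<forall>\<^sub>F t in at_top. H t \<le> M * ((A * C\<^sup>2 + D) * t powr (- 2 / 3) + D' * t powr (- \<eta>))"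
      using H0 H_le by (auto intro: eventually_at_top_linorderI[of s])
    moreover have "((\<lambda>t. M * ((A * C\<^sup>2 + D) * t powr (- 2 / 3) + D' * t powr (- \<eta>))) \<longlongrightarrow> 0) at_top"
      using tendsto_mult_right_zero[OF rate] .
    ultimately have H: "(H \<longlongrightarrow> 0) at_top"
      by (rule tendsto_sandwich[OF _ _ tendsto_const])
    have "0 \<le> H s + F s"
    proof (rule nonneg_of_decreasing_to_0[of s "\<lambda>t. H t + F t" "\<lambda>t. h t + f t"])
      show "((\<lambda>t. H t + F t) \<longlongrightarrow> 0) at_top"
        using tendsto_add[OF H F_tendsto] by simp
      show "((\<lambda>t. H t + F t) has_real_derivative h t + f t) (at t)" if "t \<ge> s" for t
        using DERIV_add[OF Hd[OF that] Fd[OF that]] .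
      show "h t + f t \<le> 0" if "t \<ge> s" for t using fh[OF that] by linarith
    qed
    moreover have "0 \<le> H s - F s"
    proof (rule nonneg_of_decreasing_to_0[of s "\<lambda>t. H t - F t" "\<lambda>t. h t - f t"])
      show "((\<lambda>t. H t - F t) \<longlongrightarrow> 0) at_top"
        using tendsto_diff[OF H F_tendsto] by simp
      show "((\<lambda>t. H t - F t) has_real_derivative h t - f t) (at t)" if "t \<ge> s" for t
        using DERIV_diff[OF Hd[OF that] Fd[OF that]] .
      show "h t - f t \<le> 0" if "t \<ge> s" for t using fh[OF that] by linarith
    qed
    ultimately have "\<bar>F s\<bar> \<le> H s" by linarith
    then show ?thesis using H_le[of s] by simp
  qed
  have "\<forall>\<^sub>F s in at_top. (A * C\<^sup>2 + D) * s powr (- 2 / 3) + D' * s powr (- \<eta>) < e"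
    using order_tendstoD(2)[OF rate assms] .
  \<comment> \<open>The rate does not involve \<open>M\<close>, so one threshold serves every
    dominating bound.\<close>
  then obtain S where
    S: "\<And>s. S \<le> s \<Longrightarrow> (A * C\<^sup>2 + D) * s powr (- 2 / 3) + D' * s powr (- \<eta>) < e"
    by (auto simp: eventually_at_top_linorder)
  show thesis
  proof
    fix s M assume "dominated s M" "S \<le> s"
    then show "\<bar>F s\<bar> \<le> e * M"
      using main[of s M] mult_left_mono[OF less_imp_le[OF S[of s]], of M] dominated_nonneg[of s M]
      by (simp add: mult.commute)
  qed
qed

section \<open>Eventual monotonicity of the weighted profile\<close>

text \<open>Decay makes the half-line effectively compact: beyond some point the weighted profile
  stays below its value at a fixed \<open>r\<close> with \<open>\<theta> r \<noteq> 0\<close>, so a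
  maximum over a compact interval is global.\<close>

lemma max_attained:
  assumes "s \<ge> 1"
  obtains t where "s \<le> t" "\<And>u. s \<le> u \<Longrightarrow> u powr a * \<bar>\<theta> u\<bar> \<le> t powr a * \<bar>\<theta> t\<bar>"
proof (cases "\<forall>u\<ge>s. \<theta> u = 0")
  case True
  then show ?thesis by (intro that[of s]) auto
next
  case False
  define g where "g u = u powr a * \<bar>\<theta> u\<bar>" for u
  obtain r where r: "r \<ge> s" "\<theta> r \<noteq> 0" using False by blast
  have gr: "0 < min 1 (g r)" using r assms unfolding g_def by simp
  then obtain T where T: "dominated T (min 1 (g r))" using eventually_dominated by force
  have "continuous_on {s..max T r} g"
    unfolding g_def using assms \<theta>_deriv
    by (intro continuous_intros continuous_on_powr' DERIV_continuous_on[of _ _ v])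
      (auto intro: has_field_derivative_at_within)
  then obtain t where t: "t \<in> {s..max T r}" "\<And>u. u \<in> {s..max T r} \<Longrightarrow> g u \<le> g t"
    using continuous_attains_sup[of "{s..max T r}" g] r by fastforce
  have "g u \<le> g t" if "u \<ge> s" for u
  proof (cases "u \<le> max T r")
    case True
    then show ?thesis using t(2) that by simp
  next
    case False
    then have "g u \<le> g r" using T unfolding dominated_def g_def by auto
    also have "g r \<le> g t" using t(2) r by simp
    finally show ?thesis .
  qed
  then show ?thesis using t(1) unfolding g_def by (intro that[of t]) auto
qed

text \<open>Squaring removes the absolute value and keeps the maximum, so the derivative of the
  square vanishes; the nonzero factor t^a \<theta>(t) is then cancelled.\<close>

lemma critical_point:
  assumes "0 < d" "d < t"
    and max: "\<And>u. \<bar>t - u\<bar> < d \<Longrightarrow> u powr a * \<bar>\<theta> u\<bar> \<le> t powr a * \<bar>\<theta> t\<bar>"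
    and "\<theta> t \<noteq> 0"
  shows "v t = - a * \<theta> t / t"
proof -
  let ?G = "\<lambda>u. (u powr a * \<theta> u)\<^sup>2"
  have t: "t > 0" using assms by simp
  have e: "t powr a = t * t powr (a - 1)" using t powr_mult_base[of t "a - 1"] by simp
  have "((\<lambda>u. u powr a * \<theta> u) has_real_derivative
      a * t powr (a - 1) * \<theta> t + v t * t powr a) (at t)"
    by (intro DERIV_mult has_real_derivative_powr t \<theta>_deriv)
  from DERIV_power[OF this, of 2] have "(?G has_real_derivative
      2 * ((a * t powr (a - 1) * \<theta> t + v t * t powr a) * (t powr a * \<theta> t))) (at t)"
    by simp
  moreover have "?G u \<le> ?G t" if "\<bar>t - u\<bar> < d" for u
    using max[OF that] assms by (simp add: abs_le_square_iff[symmetric] abs_mult)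
  ultimately have "2 * ((a * t powr (a - 1) * \<theta> t + v t * t powr a) * (t powr a * \<theta> t)) = 0"
    using DERIV_local_max assms(1) by blast
  then have "a * t powr (a - 1) * \<theta> t + v t * t powr a = 0" using t assms(4) by simp
  then have "t powr (a - 1) * (a * \<theta> t + v t * t) = 0" unfolding e by (simp add: algebra_simps)
  then have "a * \<theta> t + v t * t = 0" using t by simp
  then show ?thesis using t by (simp add: field_simps)
qed

text \<open>At an interior maximum of \<^term>\<open>s powr a * \<bar>\<theta> s\<bar>\<close> the bound on \<^term>\<open>F\<close> would force
  $|v|^k \ge (b/2) t |\theta|$, whereas criticality makes $|v|^k$ far smaller.\<close>

lemma eventually_dominated_by_self:
  obtains S where "\<And>s. S \<le> s \<Longrightarrow> dominated s (s powr a * \<bar>\<theta> s\<bar>)"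
    "\<And>s. S \<le> s \<Longrightarrow> \<bar>F s\<bar> \<le> b / 2 * (s powr a * \<bar>\<theta> s\<bar>)"
proof -
  obtain S0 where S0: "dominated S0 1" using eventually_dominated[of 1] by auto
  \<comment> \<open>With b/2, at least half of the term b s^a \<theta> in \<open>F\<close> must be
    balanced by \<open>v ^ k\<close>.\<close>
  obtain S1 where S1: "\<And>s M. dominated s M \<Longrightarrow> S1 \<le> s \<Longrightarrow> \<bar>F s\<bar> \<le> b / 2 * M"
    using F_bound[of "b / 2"] b_pos by auto
  \<comment> \<open>An interior maximum at \<open>t\<close> will force
    \<open>t \<le> 2 * a ^ k / b\<close>; the last entry excludes this.\<close>
  define S where "S = max (max 1 S0) (max S1 (2 * a ^ k / b + 1))"
  have self: "dominated s (s powr a * \<bar>\<theta> s\<bar>)" if "S \<le> s" for s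
  proof -
    have s: "s \<ge> 1" "s \<ge> S0" "s \<ge> S1" "2 * a ^ k / b < s" using that unfolding S_def by auto
    obtain t where t: "s \<le> t" "\<And>u. s \<le> u \<Longrightarrow> u powr a * \<bar>\<theta> u\<bar> \<le> t powr a * \<bar>\<theta> t\<bar>"
      using max_attained[OF s(1)] by blast
    have t1: "t \<ge> 1" using s t by simp
    have "t powr a * \<bar>\<theta> t\<bar> \<le> 1" using S0 s t unfolding dominated_def by auto
    then have dom: "dominated s (t powr a * \<bar>\<theta> t\<bar>)" using s t unfolding dominated_def by auto
    show ?thesis
    proof (cases "t = s \<or> \<theta> t = 0")
      case True
      then show ?thesis
      proof
        assume "\<theta> t = 0"
        then have "s powr a * \<bar>\<theta> s\<bar> = t powr a * \<bar>\<theta> t\<bar>"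
          using t(2)[of s] by (intro order_antisym) auto
        then show ?thesis using dom by metis
      qed (use dom in simp)
    next
      case False
      \<comment> \<open>The radius \<open>t - s\<close> keeps the neighbourhood inside the region
        where \<open>t\<close> is known to be maximal.\<close>
      have vt: "v t = - a * \<theta> t / t"
        using False t s(1) by (intro critical_point[of "t - s"]) auto
      have th: "\<bar>\<theta> t\<bar> \<le> 1" using dominated_le_1[OF dom t(1)] .
      have "\<bar>F t\<bar> \<le> b / 2 * (t powr a * \<bar>\<theta> t\<bar>)"
        using S1[OF dominated_mono[OF dom t(1)]] s t by simp
      moreover have "\<bar>b * (t powr a * \<theta> t)\<bar> \<le> \<bar>F t\<bar> + \<bar>t powr (a - 1) * v t ^ k\<bar>"
        unfolding F_def by linarith
      ultimately have "b * (t powr a * \<bar>\<theta> t\<bar>) \<le> b / 2 * (t powr a * \<bar>\<theta> t\<bar>) + t powr (a - 1) * \<bar>v t ^ k\<bar>"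
        using b_pos by (simp add: abs_mult)
      moreover have "t powr a = t powr (a - 1) * t"
        using t1 powr_mult_base[of t "a - 1"] by (simp add: mult.commute)
      ultimately have "t powr (a - 1) * (b / 2 * t * \<bar>\<theta> t\<bar>) \<le> t powr (a - 1) * \<bar>v t ^ k\<bar>"
        by (simp add: algebra_simps)
      then have lower: "b / 2 * t * \<bar>\<theta> t\<bar> \<le> \<bar>v t ^ k\<bar>" using t1 by simp
      have "\<bar>v t\<bar> \<le> a * \<bar>\<theta> t\<bar>"
        unfolding vt using t1 a_pos mult_left_mono[of 1 t "a * \<bar>\<theta> t\<bar>"]
        by (simp add: abs_mult pos_divide_le_eq)
      then have "\<bar>v t\<bar> ^ k \<le> (a * \<bar>\<theta> t\<bar>) ^ k" by (intro power_mono) auto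
      also have "\<dots> \<le> a ^ k * \<bar>\<theta> t\<bar>"
        unfolding power_mult_distrib using th a_pos power_le_self[of "\<bar>\<theta> t\<bar>"]
        by (intro mult_left_mono) auto
      finally have "(b / 2 * t) * \<bar>\<theta> t\<bar> \<le> a ^ k * \<bar>\<theta> t\<bar>" using lower by (simp add: power_abs)
      then have "b / 2 * t \<le> a ^ k" using False by simp
      then have "t \<le> 2 * a ^ k / b" using b_pos by (simp add: field_simps)
      then show ?thesis using s(4) t(1) by linarith
    qed
  qed
  show thesis
  proof (rule that)
    fix s assume "S \<le> s"
    then show "dominated s (s powr a * \<bar>\<theta> s\<bar>)" using self by simp
    then show "\<bar>F s\<bar> \<le> b / 2 * (s powr a * \<bar>\<theta> s\<bar>)"
      using S1 \<open>S \<le> s\<close> unfolding S_def by simp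
  qed
qed

section \<open>Extinction in finite time\<close>

text \<open>As long as \<^term>\<open>\<theta>\<close> does not vanish, $|\theta|^{2/3}$ decreases at rate at least
  $2/3$.\<close>

lemma eventually_zero: "\<exists>R>0. \<forall>s\<ge>R. \<theta> s = 0"
proof (rule ccontr)
  assume contra: "\<not> ?thesis"
  obtain S0 where S0: "\<And>s. S0 \<le> s \<Longrightarrow> dominated s (s powr a * \<bar>\<theta> s\<bar>)"
    "\<And>s. S0 \<le> s \<Longrightarrow> \<bar>F s\<bar> \<le> b / 2 * (s powr a * \<bar>\<theta> s\<bar>)"
    using eventually_dominated_by_self by blast
  \<comment> \<open>The entry \<open>2 / b\<close> ensures \<open>b / 2 * s \<ge> 1\<close>.\<close>
  define S where "S = max S0 (max 1 (2 / b))"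
  \<comment> \<open>A zero at \<open>s\<close> would make \<theta> dominated with
    \<open>M = 0\<close>, hence zero from there on.\<close>
  have nz: "\<theta> s \<noteq> 0" if "S \<le> s" for s
  proof
    assume "\<theta> s = 0"
    have s: "s \<ge> 1" "dominated s (s powr a * \<bar>\<theta> s\<bar>)" using that S0(1) unfolding S_def by auto
    have "\<theta> t = 0" if "t \<ge> s" for t
      using dominated_bound[OF s(2) that] \<open>\<theta> s = 0\<close> by simp
    then show False using contra s(1) by (meson less_le_trans zero_less_one)
  qed
  \<comment> \<open>The bound on \<open>F\<close> puts v^k within (b/2) s |\<theta>| of -b s
    \<theta>. Hence \<open>v\<close> has the sign opposite to \<theta>, and |v|^k \<ge> (b/2) s
    |\<theta>|.\<close>
  have speed: "v s * \<theta> s \<le> - (((\<theta> s)\<^sup>2) powr (2 / 3))" if ss: "S \<le> s" for s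
  proof -
    have s: "s \<ge> 1" "S0 \<le> s" "s \<ge> 2 / b" using ss unfolding S_def by auto
    have th: "0 < \<bar>\<theta> s\<bar>" "\<bar>\<theta> s\<bar> \<le> 1" using nz[OF ss] dominated_le_1[OF S0(1)[OF s(2)]] by auto
    define x where "x = \<theta> s"
    \<comment> \<open>The exponent 1/3 works for every odd k > 1: as |x| \<le> 1 and k \<ge> 3,
      \<open>y ^ k\<close> is at most |x|.\<close>
    define y where "y = \<bar>x\<bar> powr (1 / 3)"
    have y: "0 < y" "y \<le> 1" unfolding y_def using th x_def by (auto simp: powr_le1)
    have "s powr a = s powr (a - 1) * s" using s powr_mult_base[of s "a - 1"] by (simp add: mult.commute)
    moreover from this have "F s = s powr (a - 1) * (v s ^ k + b * s * x)"
      unfolding F_def x_def by (simp add: algebra_simps)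
    then have "\<bar>F s\<bar> = s powr (a - 1) * \<bar>v s ^ k + b * s * x\<bar>" by (simp add: abs_mult)
    ultimately have "s powr (a - 1) * \<bar>v s ^ k + b * s * x\<bar> \<le> s powr (a - 1) * (b / 2 * s * \<bar>x\<bar>)"
      using S0(2)[OF s(2)] unfolding x_def by (simp add: mult.assoc mult.left_commute)
    then have F: "\<bar>v s ^ k + b * s * x\<bar> \<le> b / 2 * s * \<bar>x\<bar>" using s by simp
    have bs: "b / 2 * s \<ge> 1" using s(3) b_pos by (simp add: field_simps)
    have y3: "y ^ 3 = \<bar>x\<bar>" unfolding y_def using th x_def by (simp add: powr_power)
    have yk: "y ^ k \<le> \<bar>x\<bar>" unfolding y3[symmetric] using y k_ge_3 by (intro power_decreasing) auto
    also have "\<dots> \<le> b / 2 * s * \<bar>x\<bar>" using bs mult_right_mono[of 1 "b / 2 * s" "\<bar>x\<bar>"] by simp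
    finally have ybs: "y ^ k \<le> b / 2 * s * \<bar>x\<bar>" .
    have "v s * x \<le> - (y * \<bar>x\<bar>)"
    proof (cases "x > 0")
      case True
      then have "b * s * x = 2 * (b / 2 * s * \<bar>x\<bar>)" by simp
      then have "v s ^ k \<le> - (y ^ k)" using F ybs by linarith
      then have "v s ^ k \<le> (- y) ^ k" using odd_k by simp
      then have "v s \<le> - y" by (rule odd_power_le_imp_le[OF odd_k])
      then show ?thesis using True mult_right_mono[of "v s" "- y" x] by simp
    next
      case False
      then have "b * s * x = - 2 * (b / 2 * s * \<bar>x\<bar>)" by simp
      then have "y ^ k \<le> v s ^ k" using F ybs by linarith
      then have "y \<le> v s" by (rule odd_power_le_imp_le[OF odd_k])
      then show ?thesis using False mult_right_mono_neg[of y "v s" x] by simp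
    qed
    also have "y * \<bar>x\<bar> = (x\<^sup>2) powr (2 / 3)"
    proof -
      have "x\<^sup>2 = \<bar>x\<bar> powr 2" using th x_def by simp
      then have "(x\<^sup>2) powr (2 / 3) = \<bar>x\<bar> powr (4 / 3)" by (simp only: powr_powr) simp
      also have "\<dots> = y * \<bar>x\<bar>"
        unfolding y_def using th x_def powr_add[of "\<bar>x\<bar>" "1 / 3" 1] by simp
      finally show ?thesis by simp
    qed
    finally show ?thesis unfolding x_def .
  qed
  \<comment> \<open>This is |\<theta>|^(2/3), written through the square to avoid sign cases; the
    chain rule cancels the power in \<open>speed\<close> exactly.\<close>
  define Z where "Z s = ((\<theta> s)\<^sup>2) powr (1 / 3)" for s
  have Zd: "\<exists>y. (Z has_real_derivative y) (at s) \<and> y \<le> - 2 / 3" if ss: "S \<le> s" for s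
  proof -
    have s: "s > 0" using ss unfolding S_def by auto
    have pos: "(\<theta> s)\<^sup>2 > 0" using nz[OF ss] by simp
    have "((\<lambda>s. (\<theta> s)\<^sup>2) has_real_derivative 2 * (v s * \<theta> s)) (at s)"
      by (auto intro!: derivative_eq_intros \<theta>_deriv s)
    then have "(Z has_real_derivative
        (1 / 3 * ((\<theta> s)\<^sup>2) powr (1 / 3 - 1)) * (2 * (v s * \<theta> s))) (at s)"
      unfolding Z_def by (rule DERIV_chain2[where g = "\<lambda>s. (\<theta> s)\<^sup>2", OF has_real_derivative_powr[OF pos]])
    moreover have "(1 / 3 * ((\<theta> s)\<^sup>2) powr (1 / 3 - 1)) * (2 * (v s * \<theta> s))
        \<le> (1 / 3 * ((\<theta> s)\<^sup>2) powr (1 / 3 - 1)) * (2 * (- (((\<theta> s)\<^sup>2) powr (2 / 3))))"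
      using speed[OF ss] by (intro mult_left_mono) auto
    moreover have "((\<theta> s)\<^sup>2) powr (1 / 3 - 1) * ((\<theta> s)\<^sup>2) powr (2 / 3) = 1"
      using pos nz[OF ss] by (simp add: powr_add[symmetric])
    ultimately show ?thesis by (intro exI conjI) (auto simp: mult.commute)
  qed
  \<comment> \<open>At slope -2/3 the interval of length \<open>3 / 2 * Z S\<close> uses up
    \<open>Z S\<close>; the extra 1 makes \<open>Z T\<close> negative.\<close>
  define T where "T = S + 3 / 2 * Z S + 1"
  have Z0: "Z s \<ge> 0" for s unfolding Z_def by simp
  have "Z T + 2 / 3 * T \<le> Z S + 2 / 3 * S"
  proof (rule DERIV_nonpos_imp_nonincreasing[of S T "\<lambda>s. Z s + 2 / 3 * s"])
    show "S \<le> T" unfolding T_def using Z0[of S] by simp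
    fix s assume "S \<le> s" "s \<le> T"
    then obtain y where y: "(Z has_real_derivative y) (at s)" "y \<le> - 2 / 3" using Zd by blast
    have "((\<lambda>s. Z s + 2 / 3 * s) has_real_derivative y + 2 / 3) (at s)"
      using y(1) by (auto intro!: derivative_eq_intros)
    then show "\<exists>y. ((\<lambda>s. Z s + 2 / 3 * s) has_real_derivative y) (at s) \<and> y \<le> 0"
      using y(2) by (intro exI[of _ "y + 2 / 3"]) simp
  qed
  moreover have "2 / 3 * T = 2 / 3 * S + Z S + 2 / 3" unfolding T_def by simp
  ultimately show False using Z0[of T] by linarith
qed

end

section \<open>Application to solutions of the equation\<close>

theorem proposition5p2:
  fixes n k :: nat and q \<kappa> :: real and \<theta> :: "real \<Rightarrow> real"
  assumes "n > 2" and "1 \<le> k" and "k \<le> n" and "odd k"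
    and "q > real k" and "\<kappa> > 0"
    and "k > 1"
    and "is_solution n k q \<kappa> \<theta>"
    and "((\<lambda>s. s powr (\<kappa> / b_coef k) * \<theta> s) \<longlongrightarrow> 0) at_top"
  shows "has_compact_support \<theta>"
proof -
  have k: "real k > 1" using \<open>k > 1\<close> by simp
  have b: "b_coef k > 0" unfolding b_coef_def using k by simp
  have "real n * (real k + 1) \<ge> 2 * (real k + 1)" using \<open>n > 2\<close> k by (intro mult_right_mono) auto
  then have \<delta>: "delta_exp n k \<ge> 0" unfolding delta_exp_def using k by simp
  have \<theta>: "(\<theta> has_real_derivative deriv \<theta> s) (at s)" if "s > 0" for s
    using assms(8) that DERIV_deriv_iff_real_differentiable
      C1_differentiable_on_eq[of \<theta> "{0<..}"]
    unfolding is_solution_def by auto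
  \<comment> \<open>The product rule is expanded and the positive factor s^\<delta> divided out;
    \<kappa> is written as \<open>\<kappa> / b_coef k * b_coef k\<close> to match
    \<open>power_deriv\<close>.\<close>
  have w: "((\<lambda>t. deriv \<theta> t ^ k) has_real_derivative
      - (delta_exp n k / s) * deriv \<theta> s ^ k - b_coef k * s * deriv \<theta> s
        - (\<kappa> / b_coef k * b_coef k * \<theta> s
          + inverse (c_coef n k) * (\<bar>\<theta> s\<bar> powr (q - 1) * \<theta> s))) (at s)" if s: "s > 0" for s
  proof -
    define p where "p = s powr delta_exp n k"
    define w' where "w' = deriv (\<lambda>t. deriv \<theta> t ^ k) s"
    have p: "p > 0" using s unfolding p_def by simp
    have wd: "((\<lambda>t. deriv \<theta> t ^ k) has_real_derivative w') (at s)"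
      using assms(8) s DERIV_deriv_iff_real_differentiable
        C1_differentiable_on_eq[of "\<lambda>t. deriv \<theta> t ^ k" "{0<..}"]
      unfolding is_solution_def w'_def by auto
    have "((\<lambda>t. t powr delta_exp n k * deriv \<theta> t ^ k) has_real_derivative
        delta_exp n k * s powr (delta_exp n k - 1) * deriv \<theta> s ^ k + w' * s powr delta_exp n k) (at s)"
      by (intro DERIV_mult has_real_derivative_powr s wd)
    then have "deriv (\<lambda>t. t powr delta_exp n k * deriv \<theta> t ^ k) s
        = p * (delta_exp n k / s * deriv \<theta> s ^ k + w')"
      unfolding p_def using s by (simp add: DERIV_imp_deriv powr_diff algebra_simps)
    then have "p * (delta_exp n k / s * deriv \<theta> s ^ k + w' + (b_coef k * s * deriv \<theta> s + \<kappa> * \<theta> s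
        + inverse (c_coef n k) * (\<bar>\<theta> s\<bar> powr (q - 1) * \<theta> s))) = 0"
      using assms(8) s unfolding is_solution_def p_def by (metis (no_types, lifting) add.assoc distrib_left)
    then have "delta_exp n k / s * deriv \<theta> s ^ k + w' + (b_coef k * s * deriv \<theta> s + \<kappa> * \<theta> s
        + inverse (c_coef n k) * (\<bar>\<theta> s\<bar> powr (q - 1) * \<theta> s)) = 0" using p by simp
    then have "w' = - (delta_exp n k / s) * deriv \<theta> s ^ k - b_coef k * s * deriv \<theta> s
        - (\<kappa> / b_coef k * b_coef k * \<theta> s
          + inverse (c_coef n k) * (\<bar>\<theta> s\<bar> powr (q - 1) * \<theta> s))"
      using b by simp
    then show ?thesis using wd by simp
  qed
  interpret profile k "delta_exp n k" "b_coef k" "\<kappa> / b_coef k" "inverse (c_coef n k)" q \<theta> "deriv \<theta>"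
    using assms b k \<delta> \<theta> w by unfold_locales (auto simp: c_coef_def)
  show ?thesis unfolding has_compact_support_def by (rule eventually_zero)
qed

end
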